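(* (1) Let $p$ be an odd prime and $n\in\mathbb{N}$ with $p^n\neq 3$, and let $C_2(H)$ be the binary code generated by an incidence matrix $H$ of the unit graph $G(\mathbb{Z}_{p^n})$. Then the dual code $C_2(H)^{\perp}$ is a $\left[\frac{(p^{n}-1)\phi(p^{n})}{2},\,\frac{(p^{n}-1)[\phi(p^{n})-2]}{2},\,3\right]_{2}$ code. (2) Let $n\in\mathbb{N}$, let $q$ be an odd prime, and let $C_q(H)$ be the $q$-ary code generated by an incidence matrix $H$ of the unit graph $G(\mathbb{Z}_{2^n})$. Then the dual code $C_q(H)^{\perp}$ is a $\left[2^{2(n-1)},\,2^{n}(2^{n-2}-1)+1,\,4\right]_{q}$ code.
   Context: $\mathbb{N}$ denotes the set of positive integers. The unit graph $G(\mathbb{Z}_N)$ is the simple graph with vertex set $\mathbb{Z}_N$ in which two distinct vertices $x,y$ are adjacent iff $x+y$ is a unit of $\mathbb{Z}_N$. An incidence matrix of a graph $(V,E)$ has rows indexed by vertices and columns by edges, with entry $1$ if the vertex is an endpoint of the edge and $0$ otherwise. For a prime $q$, $C_q(H)$ denotes the $\mathbb{F}_q$-span of the rows of $H$ (entries read in $\mathbb{F}_q$), a subspace of $\mathbb{F}_q^{|E|}$. The dual $C^\perp$ of a code $C\subseteq\mathbb{F}_q^N$ is its orthogonal complement with respect to the standard bilinear form. An $[N,k,d]_q$ code is a linear subspace of $\mathbb{F}_q^N$ of dimension $k$ whose minimum Hamming weight of nonzero vectors (equivalently, minimum distance) is $d$. $\phi$ is Euler's totient function.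
   Formalization: In part (2) the minimum distance 4 is claimed only for n ≥ 2; for n = 1 the unit graph of Z_2 has a single edge and the dual code is zero, so it has no minimum weight, and only length 1 and dimension 0 are asserted. *)

theory Defs
  imports
    "HOL-Library.Cardinality"
    "HOL-Number_Theory.Residues"
    "HOL-Number_Theory.Totient"
    "Jordan_Normal_Form.VS_Connect"
begin

text \<open>Simple graphs are given by a vertex set together with a set of two-element vertex sets.\<close>

definition unit_graph_edges :: "('a, 'b) ring_scheme \<Rightarrow> 'a set set" where
  "unit_graph_edges R =
     {{x, y} | x y. x \<in> carrier R \<and> y \<in> carrier R \<and> x \<noteq> y \<and> x \<oplus>\<^bsub>R\<^esub> y \<in> Units R}"

text \<open>The orderings of rows and columns are arbitrary, hence a predicate and not a function.\<close>

definition is_incidence_matrix :: "'a set \<Rightarrow> 'a set set \<Rightarrow> int mat \<Rightarrow> bool" where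
  "is_incidence_matrix V E H \<longleftrightarrow>
     (\<exists>vs es. distinct vs \<and> set vs = V \<and> distinct es \<and> set es = E \<and>
        H = mat (length vs) (length es) (\<lambda>(i, j). if vs ! i \<in> es ! j then 1 else 0))"

definition unit_graph_incidence :: "nat \<Rightarrow> int mat \<Rightarrow> bool" where
  "unit_graph_incidence N H \<longleftrightarrow>
     is_incidence_matrix (carrier (residue_ring (int N))) (unit_graph_edges (residue_ring (int N))) H"

text \<open>
  A prime field is any field type with the right (prime) number of elements.
\<close>

definition row_code :: "int mat \<Rightarrow> 'f::field vec set" where
  "row_code H = vec_space.row_space (dim_col H) (map_mat of_int H)"

definition linear_code :: "nat \<Rightarrow> nat \<Rightarrow> 'f::field vec set \<Rightarrow> bool" where
  "linear_code N k C \<longleftrightarrow>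
     VectorSpace.subspace class_ring C (module_vec TYPE('f) N) \<and>
     vectorspace.dim class_ring ((module_vec TYPE('f) N)\<lparr>carrier := C\<rparr>) = k"

definition hamming_weight :: "'f::zero vec \<Rightarrow> nat" where
  "hamming_weight x = card {i. i < dim_vec x \<and> x $ i \<noteq> 0}"

text \<open>
  The minimum \<open>d\<close> has to be attained, so the zero code is an \<open>[N, 0, d]\<close> code for no \<open>d\<close>.
  This concerns the unit graph of \<open>\<int>/2\<int>\<close>: it has one edge, its row code is the whole
  one-dimensional space, and the dual code is zero. For it only the length \<open>1\<close> and the dimension
  \<open>0\<close> (the value of \<open>2\<^sup>n (2\<^sup>n\<^sup>-\<^sup>2 - 1) + 1\<close> at \<open>n = 1\<close>) are meaningful.
\<close>

definition linear_code_dist :: "nat \<Rightarrow> nat \<Rightarrow> nat \<Rightarrow> 'f::field vec set \<Rightarrow> bool" where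
  "linear_code_dist N k d C \<longleftrightarrow>
     linear_code N k C \<and>
     (\<exists>x\<in>C. x \<noteq> 0\<^sub>v N \<and> hamming_weight x = d) \<and>
     (\<forall>x\<in>C. x \<noteq> 0\<^sub>v N \<longrightarrow> d \<le> hamming_weight x)"

end

theory Submission
  imports Defs "Jordan_Normal_Form.Matrix_Kernel"
begin

text \<open>
  The dual code consists of the edge weightings whose sum at every vertex vanishes. In a connected
  graph the vertex sums away from a root can be prescribed arbitrarily, and if the rows of the
  incidence matrix satisfy a linear relation (characteristic \<open>2\<close>, or a bipartite graph) then the
  sum at the root is determined by the others; so by rank-nullity the dual code has dimension
  \<open>|E| - (|V| - 1)\<close>. The support of a nonzero weighting has no vertex of degree one, so it
  contains a cycle; a triangle attains weight \<open>3\<close> in characteristic \<open>2\<close>, and an alternating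
  \<open>4\<close>-cycle weight \<open>4\<close> in the bipartite case.
\<close>

section \<open>Kernels of surjective matrices\<close>

text \<open>Rank-nullity for \<open>x \<mapsto> A *\<^sub>v x\<close>: the image is the whole space
  of dimension \<open>nr\<close>. Surjectivity forces \<open>nr \<le> nc\<close>, so the truncated
  subtraction is exact.\<close>

lemma linear_code_mat_kernel:
  fixes A :: "'f::field mat"
  assumes A: "A \<in> carrier_mat nr nc"
    and surj: "\<And>y. y \<in> carrier_vec nr \<Longrightarrow> \<exists>x\<in>carrier_vec nc. A *\<^sub>v x = y"
  shows "linear_code nc (nc - nr) (mat_kernel A)"
proof -
  interpret lin: linear_map class_ring "module_vec TYPE('f) nc" "module_vec TYPE('f) nr" "\<lambda>x. A *\<^sub>v x"
  proof -
    interpret nc: vec_space "TYPE('f)" nc .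
    interpret nr: vec_space "TYPE('f)" nr .
    show "linear_map class_ring (module_vec TYPE('f) nc) (module_vec TYPE('f) nr) (\<lambda>x. A *\<^sub>v x)"
      by unfold_locales
        (use A in \<open>auto simp: module_hom_def module_vec_simps mult_add_distrib_mat_vec mult_mat_vec\<close>)
  qed
  have ker: "lin.kerT = mat_kernel A"
    using A by (auto simp: lin.ker_def mat_kernel module_vec_simps)
  have "(\<lambda>x. A *\<^sub>v x) ` carrier_vec nc = carrier_vec nr"
    using surj A by force
  hence im: "lin.imT = carrier (module_vec TYPE('f) nr)"
    by (simp add: lin.im_def module_vec_simps)
  interpret nc: vec_space "TYPE('f)" nc .
  interpret nr: vec_space "TYPE('f)" nr .
  have "vectorspace.dim class_ring (nr.V\<lparr>carrier := lin.imT\<rparr>) + vectorspace.dim class_ring (nc.V\<lparr>carrier := lin.kerT\<rparr>) = vectorspace.dim class_ring nc.V"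
    by (rule lin.rank_nullity[OF nc.fin_dim])
  moreover have "vectorspace.dim class_ring (nr.V\<lparr>carrier := lin.imT\<rparr>) = nr"
  proof -
    have "nr.V\<lparr>carrier := carrier nr.V\<rparr> = nr.V" by (simp add: module_vec_def)
    thus ?thesis by (simp only: im nr.dim_is_n)
  qed
  ultimately have "vectorspace.dim class_ring (nc.V\<lparr>carrier := mat_kernel A\<rparr>) = nc - nr"
    using ker nc.dim_is_n by simp
  with lin.kerT_is_subspace show ?thesis
    unfolding linear_code_def ker by simp
qed

section \<open>The dual code of an incidence matrix as a cycle space\<close>

text \<open>The entry at \<open>v\<close> of the incidence matrix times \<open>w\<close>. Weightings
  are functions on edges rather than vectors, so that the graph arguments do not depend on the order
  of the columns.\<close>

definition vertex_sum :: "'a set set \<Rightarrow> ('a set \<Rightarrow> 'f::comm_monoid_add) \<Rightarrow> 'a \<Rightarrow> 'f" where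
  "vertex_sum E w v = sum w {e \<in> E. v \<in> e}"

lemma vertex_sum_nth:
  fixes w :: "'a set \<Rightarrow> 'f::comm_semiring_1"
  assumes "distinct es"
  shows "(\<Sum>j<length es. of_bool (v \<in> es ! j) * w (es ! j)) = vertex_sum (set es) w v"
proof -
  have "(\<Sum>j<length es. of_bool (v \<in> es ! j) * w (es ! j)) = (\<Sum>e\<in>set es. of_bool (v \<in> e) * w e)"
    using sum.reindex_bij_betw[OF bij_betw_nth[OF assms refl refl], of "\<lambda>e. of_bool (v \<in> e) * w e"]
    by simp
  also have "\<dots> = vertex_sum (set es) w v"
    unfolding vertex_sum_def by (rule sum.mono_neutral_cong_right) auto
  finally show ?thesis .
qed

text \<open>Every edge has exactly one index in a list without repetitions, so coordinates can be
  read as weights of edges.\<close>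

lemma vec_edge_function:
  assumes "distinct es" "x \<in> carrier_vec (length es)"
  obtains w where "x = vec (length es) (\<lambda>j. w (es ! j))"
proof
  show "x = vec (length es) (\<lambda>j. (\<lambda>e. x $ (THE j. j < length es \<and> es ! j = e)) (es ! j))"
  proof (rule eq_vecI)
    fix i assume i: "i < dim_vec (vec (length es) (\<lambda>j. (\<lambda>e. x $ (THE j. j < length es \<and> es ! j = e)) (es ! j)))"
    hence "(THE j. j < length es \<and> es ! j = es ! i) = i"
      using assms(1) by (intro the_equality) (auto simp: nth_eq_iff_index_eq)
    with i show "x $ i = vec (length es) (\<lambda>j. (\<lambda>e. x $ (THE j. j < length es \<and> es ! j = e)) (es ! j)) $ i"
      by simp
  qed (use assms in auto)
qed

text \<open>The entries lie directly in the field, and \<open>vs\<close> may be any list of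
  vertices; this allows the row of one vertex to be dropped.\<close>

definition incidence_list :: "'a list \<Rightarrow> 'a set list \<Rightarrow> 'f::zero_neq_one mat" where
  "incidence_list vs es = mat (length vs) (length es) (\<lambda>(i, j). of_bool (vs ! i \<in> es ! j))"

lemma incidence_list_carrier [simp]:
  "incidence_list vs es \<in> carrier_mat (length vs) (length es)"
  by (simp add: incidence_list_def)

lemma incidence_list_mult_vec:
  fixes w :: "'a set \<Rightarrow> 'f::field"
  assumes "distinct es"
  shows "incidence_list vs es *\<^sub>v vec (length es) (\<lambda>j. w (es ! j))
    = vec (length vs) (\<lambda>i. vertex_sum (set es) w (vs ! i))"
  by (rule eq_vecI)
    (simp_all add: incidence_list_def scalar_prod_def lessThan_atLeast0[symmetric] vertex_sum_nth[OF assms])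

lemma mem_mat_kernel_incidence_list:
  fixes w :: "'a set \<Rightarrow> 'f::field"
  assumes "distinct es"
  shows "vec (length es) (\<lambda>j. w (es ! j)) \<in> mat_kernel (incidence_list vs es)
    \<longleftrightarrow> (\<forall>v\<in>set vs. vertex_sum (set es) w v = 0)"
  unfolding mat_kernel[OF incidence_list_carrier] mem_Collect_eq incidence_list_mult_vec[OF assms]
  by (auto simp: vec_eq_iff all_set_conv_all_nth)

lemma dual_row_code:
  fixes H :: "int mat"
  defines "C \<equiv> vec_module.orthogonal_complement (dim_col H) (row_code H :: 'f::field vec set)"
  assumes H: "H = mat (length vs) (length es) (\<lambda>(i, j). if vs ! i \<in> es ! j then 1 else 0)"
  shows "C = mat_kernel (incidence_list vs es)"
proof -
  define B :: "'f mat" where "B = incidence_list vs es"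
  have B: "B \<in> carrier_mat (length vs) (length es)" by (simp add: B_def)
  have map: "map_mat of_int H = B"
    unfolding H B_def incidence_list_def by (rule eq_matI) auto
  interpret vec_space "TYPE('f)" "length es" .
  have "set (rows B) \<subseteq> carrier_vec (length es)"
    using rows_carrier[of B] B by simp
  moreover have "dim_col H = length es" by (simp add: H)
  \<comment> \<open>A vector orthogonal to all rows is orthogonal to their span.\<close>
  ultimately have "C = orthogonal_complement (set (rows B))"
    by (simp add: C_def row_code_def map row_space_def)
  also have "\<dots> = mat_kernel B"
    unfolding orthogonal_complement_def mat_kernel[OF B]
  proof (intro Collect_cong conj_cong refl)
    fix x :: "'f vec" assume x: "x \<in> carrier_vec (length es)"
    have "x \<bullet> row B i = row B i \<bullet> x" if "i < length vs" for i
      using comm_scalar_prod[OF x, of "row B i"] B that by simp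
    thus "(\<forall>y\<in>set (rows B). x \<bullet> y = 0) \<longleftrightarrow> B *\<^sub>v x = 0\<^sub>v (length vs)"
      using B by (auto simp: rows_def vec_eq_iff)
  qed
  finally show ?thesis by (simp add: B_def)
qed

lemma hamming_weight_vec_edge_function:
  assumes "distinct es"
  shows "hamming_weight (vec (length es) (\<lambda>j. w (es ! j))) = card {e \<in> set es. w e \<noteq> 0}"
proof -
  have "(!) es ` {i. i < length es \<and> w (es ! i) \<noteq> 0} = {e \<in> set es. w e \<noteq> 0}"
    by (auto simp: in_set_conv_nth)
  moreover have "card ((!) es ` {i. i < length es \<and> w (es ! i) \<noteq> 0})
      = card {i. i < length es \<and> w (es ! i) \<noteq> 0}"
    using assms by (intro card_image inj_on_nth) auto
  ultimately have "card {i. i < length es \<and> w (es ! i) \<noteq> 0} = card {e \<in> set es. w e \<noteq> 0}"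
    by simp
  thus ?thesis unfolding hamming_weight_def by (simp cong: conj_cong)
qed

section \<open>Cycle spaces of simple graphs\<close>

lemma vertex_sum_add:
  "vertex_sum E (\<lambda>e. f e + g e) v = vertex_sum E f v + vertex_sum E g v"
  by (simp add: vertex_sum_def sum.distrib)

lemma vertex_sum_diff:
  fixes f g :: "'a set \<Rightarrow> 'f::ab_group_add"
  shows "vertex_sum E (\<lambda>e. f e - g e) v = vertex_sum E f v - vertex_sum E g v"
  by (simp add: vertex_sum_def sum_subtractf)

locale finite_simple_graph =
  fixes V :: "'a set" and E :: "'a set set"
  assumes finite_V: "finite V"
    and edgeE: "\<And>e. e \<in> E \<Longrightarrow> \<exists>u v. e = {u, v} \<and> u \<noteq> v \<and> u \<in> V \<and> v \<in> V"
begin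

lemma finite_E: "finite E"
  by (rule finite_subset[of _ "Pow V"]) (use finite_V edgeE in fastforce)+

text \<open>Indicators of single edges are the building blocks of all explicit weightings
  below.\<close>

lemma vertex_sum_edge:
  assumes "e \<in> E"
  shows "vertex_sum E (\<lambda>e'. of_bool (e' = e)) v = (of_bool (v \<in> e) :: 'f::semiring_1)"
proof (cases "v \<in> e")
  case True
  hence "{x \<in> E. v \<in> x} \<inter> {x. x = e} = {e}" using assms by auto
  thus ?thesis using True finite_E by (simp add: vertex_sum_def)
next
  case False
  hence "{x \<in> E. v \<in> x} \<inter> {x. x = e} = {}" by auto
  thus ?thesis using False finite_E by (simp add: vertex_sum_def)
qed

text \<open>Double counting of the incident pairs of a vertex and an edge. A relation
  \<open>c\<close> between the rows makes every inner sum on the right vanish.\<close>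

lemma weighted_vertex_sum:
  fixes w :: "'a set \<Rightarrow> 'f::comm_semiring_1"
  shows "(\<Sum>v\<in>V. c v * vertex_sum E w v) = (\<Sum>e\<in>E. w e * (\<Sum>v\<in>V \<inter> e. c v))"
proof -
  have "(\<Sum>v\<in>V. c v * vertex_sum E w v) = (\<Sum>v\<in>V. \<Sum>e\<in>E. if v \<in> e then c v * w e else 0)"
    unfolding vertex_sum_def sum_distrib_left
    by (intro sum.cong refl sum.inter_filter finite_E)
  also have "\<dots> = (\<Sum>e\<in>E. \<Sum>v\<in>V. if v \<in> e then c v * w e else 0)"
    by (rule sum.swap)
  also have "\<dots> = (\<Sum>e\<in>E. w e * (\<Sum>v\<in>V \<inter> e. c v))"
    unfolding sum_distrib_left
    by (rule sum.cong[OF refl]) (simp add: sum.inter_restrict[OF finite_V] mult.commute if_distrib cong: if_cong)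
  finally show ?thesis .
qed

text \<open>Walking from the root \<open>r\<close> to \<open>v\<close> with alternating signs leaves the vertex sums
  \<open>1\<close> at \<open>v\<close> and \<open>\<plusminus>1\<close> at \<open>r\<close>.\<close>

lemma connected_vertex_sum_indicator:
  assumes "(r, v) \<in> {(x, y). {x, y} \<in> E}\<^sup>*" "v \<noteq> r"
  shows "\<exists>w :: 'a set \<Rightarrow> 'f::ring_1. \<forall>u. u \<noteq> r \<longrightarrow> vertex_sum E w u = of_bool (u = v)"
proof -
  \<comment> \<open>The alternative \<open>v = r\<close> absorbs the start of the walk.\<close>
  have "v = r \<or> (\<exists>w :: 'a set \<Rightarrow> 'f. \<forall>u. u \<noteq> r \<longrightarrow> vertex_sum E w u = of_bool (u = v))"
    using assms(1)
  proof (induction rule: rtrancl_induct)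
    case base
    show ?case by simp
  next
    case (step y z)
    hence e: "{y, z} \<in> E" by simp
    with edgeE have "y \<noteq> z" by fastforce
    show ?case
    proof (cases "y = r")
      case True
      have "\<forall>u. u \<noteq> r \<longrightarrow> vertex_sum E (\<lambda>e'. of_bool (e' = {y, z})) u = (of_bool (u = z) :: 'f)"
        using True unfolding vertex_sum_edge[OF e] by auto
      thus ?thesis by blast
    next
      case False
      \<comment> \<open>The edge \<open>{y, z}\<close> has sum \<open>1\<close> at \<open>y\<close>
        and at \<open>z\<close>; subtracting \<open>w\<close> cancels the sum at \<open>y\<close>
        and changes no other vertex except possibly the root.\<close>
      with step.IH obtain w :: "'a set \<Rightarrow> 'f"
        where w: "\<And>u. u \<noteq> r \<Longrightarrow> vertex_sum E w u = of_bool (u = y)" by auto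
      have "\<forall>u. u \<noteq> r \<longrightarrow> vertex_sum E (\<lambda>e'. of_bool (e' = {y, z}) - w e') u = of_bool (u = z)"
        using \<open>y \<noteq> z\<close> by (auto simp: vertex_sum_diff vertex_sum_edge[OF e] w)
      thus ?thesis by blast
    qed
  qed
  with assms(2) show ?thesis by simp
qed

text \<open>The weightings with a single vertex sum \<open>1\<close> off the root act as a dual
  basis: combine them with the prescribed values as coefficients.\<close>

lemma connected_vertex_sum_surj:
  fixes y :: "'a \<Rightarrow> 'f::comm_ring_1"
  assumes "\<And>v. v \<in> V \<Longrightarrow> (r, v) \<in> {(x, y). {x, y} \<in> E}\<^sup>*"
  obtains w where "\<And>u. u \<in> V - {r} \<Longrightarrow> vertex_sum E w u = y u"
proof -
  have "\<forall>v\<in>V - {r}. \<exists>w :: 'a set \<Rightarrow> 'f. \<forall>u. u \<noteq> r \<longrightarrow> vertex_sum E w u = of_bool (u = v)"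
    using assms connected_vertex_sum_indicator by blast
  then obtain W :: "'a \<Rightarrow> 'a set \<Rightarrow> 'f"
    where W: "\<And>v u. v \<in> V - {r} \<Longrightarrow> u \<noteq> r \<Longrightarrow> vertex_sum E (W v) u = of_bool (u = v)"
    by metis
  have "vertex_sum E (\<lambda>e. \<Sum>v\<in>V - {r}. y v * W v e) u = y u" if u: "u \<in> V - {r}" for u
  proof -
    have "vertex_sum E (\<lambda>e. \<Sum>v\<in>V - {r}. y v * W v e) u
        = (\<Sum>v\<in>V - {r}. y v * vertex_sum E (W v) u)"
      unfolding vertex_sum_def sum_distrib_left by (rule sum.swap)
    also have "\<dots> = (\<Sum>v\<in>V - {r}. if v = u then y v else 0)"
      by (rule sum.cong) (use u W in auto)
    also have "\<dots> = y u" using u finite_V by simp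
    finally show ?thesis .
  qed
  thus ?thesis by (rule that)
qed

text \<open>The vector \<open>c\<close> is a linear relation between the rows of the incidence matrix: constantly
  \<open>1\<close> in characteristic \<open>2\<close>, and \<open>\<plusminus>1\<close> along the bipartition of a bipartite graph.\<close>

lemma linear_code_dual_incidence:
  fixes c :: "'a \<Rightarrow> 'f::field" and es :: "'a set list"
  assumes vs: "distinct vs" "set vs = V" and es: "distinct es" "set es = E"
    and conn: "\<And>v. v \<in> V \<Longrightarrow> (r, v) \<in> {(x, y). {x, y} \<in> E}\<^sup>*"
    and r: "r \<in> V" "c r \<noteq> 0"
    and rel: "\<And>u v. {u, v} \<in> E \<Longrightarrow> c u + c v = 0"
  shows "linear_code (length es) (card E - (card V - 1))
    (mat_kernel (incidence_list vs es :: 'f mat))"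
proof -
  define vs' where "vs' = removeAll r vs"
  have set_vs': "set vs' = V - {r}" and "distinct vs'"
    using vs by (auto simp: vs'_def distinct_removeAll)
  hence len: "length vs' = card V - 1"
    using distinct_card[of vs'] r by simp
  have "mat_kernel (incidence_list vs es :: 'f mat) = mat_kernel (incidence_list vs' es)"
  proof -
    \<comment> \<open>Each edge \<open>{u, v}\<close> contributes
      \<open>w e * (c u + c v) = 0\<close> to the \<open>c\<close>-weighted total of the vertex
      sums. Only the term of \<open>r\<close> survives in that total, and \<open>c r\<close> is
      invertible.\<close>
    have redundant: "vertex_sum E w r = 0" if w: "\<forall>v\<in>V - {r}. vertex_sum E w v = 0"
      for w :: "'a set \<Rightarrow> 'f"
    proof -
      have "(\<Sum>v\<in>V \<inter> e. c v) = 0" if e: "e \<in> E" for e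
      proof -
        obtain u v where "e = {u, v}" "u \<noteq> v" "u \<in> V" "v \<in> V" using edgeE[OF e] by auto
        thus ?thesis using rel[of u v] e by (simp add: Int_absorb1)
      qed
      hence "(\<Sum>v\<in>V. c v * vertex_sum E w v) = 0"
        by (simp add: weighted_vertex_sum)
      moreover have "(\<Sum>v\<in>V. c v * vertex_sum E w v) = c r * vertex_sum E w r"
        using w r(1) finite_V by (simp add: sum.remove)
      ultimately show ?thesis using r(2) by simp
    qed
    have "x \<in> mat_kernel (incidence_list vs es) \<longleftrightarrow> x \<in> mat_kernel (incidence_list vs' es)"
      if x: "x \<in> carrier_vec (length es)" for x :: "'f vec"
    proof -
      obtain w where w: "x = vec (length es) (\<lambda>j. w (es ! j))"
        using vec_edge_function[OF es(1) x] .
      show ?thesis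
        unfolding w mem_mat_kernel_incidence_list[OF es(1)] es(2) vs(2) set_vs'
        using redundant[of w] by blast
    qed
    thus ?thesis
      using mat_kernel_carrier[OF incidence_list_carrier] by blast
  qed
  \<comment> \<open>Without the row of the root the matrix is surjective by connectivity, so its
    rank is its number of rows, \<open>card V - 1\<close>.\<close>
  moreover have "linear_code (length es) (length es - length vs')
    (mat_kernel (incidence_list vs' es :: 'f mat))"
  proof (rule linear_code_mat_kernel[OF incidence_list_carrier])
    fix y :: "'f vec" assume y: "y \<in> carrier_vec (length vs')"
    obtain z where z: "\<And>i. i < length vs' \<Longrightarrow> z (vs' ! i) = y $ i"
    proof
      fix i assume "i < length vs'"
      hence "(THE j. j < length vs' \<and> vs' ! j = vs' ! i) = i"
        using \<open>distinct vs'\<close> by (intro the_equality) (auto simp: nth_eq_iff_index_eq)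
      thus "(\<lambda>v. y $ (THE j. j < length vs' \<and> vs' ! j = v)) (vs' ! i) = y $ i" by simp
    qed
    obtain w :: "'a set \<Rightarrow> 'f" where w: "\<And>u. u \<in> V - {r} \<Longrightarrow> vertex_sum E w u = z u"
      using connected_vertex_sum_surj[OF conn] by blast
    have "vertex_sum E w (vs' ! i) = y $ i" if "i < length vs'" for i
      using w[of "vs' ! i"] z[OF that] nth_mem[OF that] unfolding set_vs' by simp
    hence "incidence_list vs' es *\<^sub>v vec (length es) (\<lambda>j. w (es ! j)) = y"
      unfolding incidence_list_mult_vec[OF es(1)] es(2)
      using y by (intro eq_vecI) simp_all
    thus "\<exists>x\<in>carrier_vec (length es). incidence_list vs' es *\<^sub>v x = y"
      by (intro bexI) auto
  qed
  moreover have "length es = card E"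
    using distinct_card[OF es(1)] es(2) by simp
  ultimately show ?thesis by (simp add: len)
qed

section \<open>Minimum weight of the cycle space\<close>

text \<open>A single nonzero weight at \<open>v\<close> could not sum to zero, so the support has no
  vertex of degree one.\<close>

lemma second_support_edge:
  fixes w :: "'a set \<Rightarrow> 'f::comm_monoid_add"
  assumes w: "\<forall>v\<in>V. vertex_sum E w v = 0" and e: "e \<in> E" "w e \<noteq> 0" "v \<in> e"
  obtains x where "{v, x} \<in> E" "w {v, x} \<noteq> 0" "{v, x} \<noteq> e" "v \<noteq> x"
proof -
  have "v \<in> V" using edgeE[OF e(1)] e(3) by auto
  hence "w e + sum w ({e' \<in> E. v \<in> e'} - {e}) = 0"
    using w e finite_E by (simp add: vertex_sum_def sum.remove[of _ e, symmetric])
  with e(2) have "sum w ({e' \<in> E. v \<in> e'} - {e}) \<noteq> 0" by auto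
  then obtain e' where e': "e' \<in> E" "v \<in> e'" "e' \<noteq> e" "w e' \<noteq> 0"
    by (metis (no_types, lifting) DiffE insertI1 mem_Collect_eq sum.neutral)
  obtain a b where "e' = {a, b}" "a \<noteq> b" using edgeE[OF e'(1)] by auto
  with e' that show ?thesis by (metis doubleton_eq_iff insertE singletonD)
qed

text \<open>An edge of the support is prolonged within the support at both of its ends, which gives
  three edges. Without triangles the path so obtained does not close up, and it can be prolonged
  once more.\<close>

lemma cycle_space_support:
  fixes w :: "'a set \<Rightarrow> 'f::comm_monoid_add"
  assumes w: "\<forall>v\<in>V. vertex_sum E w v = 0" and e: "e \<in> E" "w e \<noteq> 0"
  shows "3 \<le> card {e \<in> E. w e \<noteq> 0}"
    and "(\<And>a b c. {a, b} \<in> E \<Longrightarrow> {b, c} \<in> E \<Longrightarrow> {a, c} \<notin> E) \<Longrightarrow> 4 \<le> card {e \<in> E. w e \<noteq> 0}"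
proof -
  have fin: "finite {e \<in> E. w e \<noteq> 0}" using finite_E by simp
  obtain u v where uv: "e = {u, v}" "u \<noteq> v" using edgeE[OF e(1)] by auto
  obtain x where x: "{u, x} \<in> E" "w {u, x} \<noteq> 0" "{u, x} \<noteq> e" "u \<noteq> x"
    using second_support_edge[OF w e, of u] uv by auto
  obtain y where y: "{v, y} \<in> E" "w {v, y} \<noteq> 0" "{v, y} \<noteq> e" "v \<noteq> y"
    using second_support_edge[OF w e, of v] uv by auto
  \<comment> \<open>The edge \<open>{u, x}\<close> avoids \<open>v\<close>, since otherwise it would
    be \<open>e\<close>.\<close>
  have "card {e, {u, x}, {v, y}} = 3"
    using x y uv by (auto simp: doubleton_eq_iff card_insert_if)
  thus "3 \<le> card {e \<in> E. w e \<noteq> 0}"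
    using card_mono[OF fin, of "{e, {u, x}, {v, y}}"] e x y by simp
  assume triangle_free: "\<And>a b c. {a, b} \<in> E \<Longrightarrow> {b, c} \<in> E \<Longrightarrow> {a, c} \<notin> E"
  \<comment> \<open>Otherwise \<open>u\<close>, \<open>v\<close>, \<open>y\<close> would form a
    triangle.\<close>
  have "x \<noteq> y"
    using triangle_free[of u v y] e(1) uv x(1) y(1) by auto
  obtain z where z: "{x, z} \<in> E" "w {x, z} \<noteq> 0" "{x, z} \<noteq> {u, x}" "x \<noteq> z"
    using second_support_edge[OF w x(1,2), of x] by auto
  \<comment> \<open>As \<open>x\<close> is none of \<open>u\<close>, \<open>v\<close>,
    \<open>y\<close>, the only earlier edge through \<open>x\<close> is
    \<open>{u, x}\<close>.\<close>
  have "card {e, {u, x}, {v, y}, {x, z}} = 4"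
    using x y z uv \<open>x \<noteq> y\<close> by (auto simp: doubleton_eq_iff card_insert_if)
  thus "4 \<le> card {e \<in> E. w e \<noteq> 0}"
    using card_mono[OF fin, of "{e, {u, x}, {v, y}, {x, z}}"] e x y z by simp
qed

text \<open>Each corner lies on two sides of weight \<open>1\<close>, and
  \<open>1 + 1 = 0\<close>.\<close>

lemma triangle_cycle_space:
  assumes "{a, b} \<in> E" "{b, c} \<in> E" "{a, c} \<in> E" and char_2: "(1 :: 'f::comm_ring_1) + 1 = 0"
  shows "\<exists>w :: 'a set \<Rightarrow> 'f::comm_ring_1.
    (\<forall>v. vertex_sum E w v = 0) \<and> card {e \<in> E. w e \<noteq> 0} = 3"
proof -
  define w :: "'a set \<Rightarrow> 'f"
    where "w e = of_bool (e = {a, b}) + of_bool (e = {b, c}) + of_bool (e = {a, c})" for e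
  have ne: "a \<noteq> b" "b \<noteq> c" "a \<noteq> c"
    using assms(1-3) edgeE by fastforce+
  have "vertex_sum E w v = 0" for v
    unfolding w_def vertex_sum_add using ne char_2
    by (auto simp: vertex_sum_edge assms(1-3))
  have "{e \<in> E. w e \<noteq> 0} = {{a, b}, {b, c}, {a, c}}"
    using assms(1-3) ne by (auto simp: w_def doubleton_eq_iff)
  hence "card {e \<in> E. w e \<noteq> 0} = 3"
    using ne by (auto simp: doubleton_eq_iff card_insert_if)
  with \<open>\<And>v. vertex_sum E w v = 0\<close> show ?thesis
    by (intro exI[of _ w] conjI allI)
qed

text \<open>Weights \<open>1\<close> and \<open>-1\<close> alternate around the cycle, so the two
  sides at each corner cancel. Distinct opposite corners make the four sides distinct.\<close>

lemma square_cycle_space: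
  assumes "{a, b} \<in> E" "{b, c} \<in> E" "{c, d} \<in> E" "{a, d} \<in> E" "a \<noteq> c" "b \<noteq> d"
  shows "\<exists>w :: 'a set \<Rightarrow> 'f::comm_ring_1.
    (\<forall>v. vertex_sum E w v = 0) \<and> card {e \<in> E. w e \<noteq> 0} = 4"
proof -
  define w :: "'a set \<Rightarrow> 'f"
    where "w e = of_bool (e = {a, b}) - of_bool (e = {b, c})
      + (of_bool (e = {c, d}) - of_bool (e = {a, d}))" for e
  have ne: "a \<noteq> b" "b \<noteq> c" "c \<noteq> d" "a \<noteq> d"
    using assms(1-4) edgeE by fastforce+
  have "vertex_sum E w v = 0" for v
    unfolding w_def vertex_sum_add vertex_sum_diff using ne assms(5,6)
    by (auto simp: vertex_sum_edge assms(1-4))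
  have "{e \<in> E. w e \<noteq> 0} = {{a, b}, {b, c}, {c, d}, {a, d}}"
    using assms ne by (auto simp: w_def doubleton_eq_iff)
  hence "card {e \<in> E. w e \<noteq> 0} = 4"
    using ne assms(5,6) by (auto simp: doubleton_eq_iff card_insert_if)
  with \<open>\<And>v. vertex_sum E w v = 0\<close> show ?thesis
    by (intro exI[of _ w] conjI allI)
qed

text \<open>Translates support sizes of weightings into Hamming weights. By
  \<open>d \<noteq> 0\<close> the weighting that attains \<open>d\<close> is a nonzero
  codeword.\<close>

lemma minimum_distance_dual_incidence:
  fixes es :: "'a set list"
  assumes es: "distinct es" "set es = E"
    and code: "linear_code (length es) k (mat_kernel (incidence_list vs es :: 'f::field mat))"
    and vs: "set vs = V"
    and attained: "\<exists>w :: 'a set \<Rightarrow> 'f. (\<forall>v\<in>V. vertex_sum E w v = 0) \<and> card {e \<in> E. w e \<noteq> 0} = d"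
    and bound: "\<And>(w :: 'a set \<Rightarrow> 'f) e. \<forall>v\<in>V. vertex_sum E w v = 0 \<Longrightarrow> e \<in> E \<Longrightarrow> w e \<noteq> 0
      \<Longrightarrow> d \<le> card {e \<in> E. w e \<noteq> 0}"
    and "d \<noteq> 0"
  shows "linear_code_dist (length es) k d (mat_kernel (incidence_list vs es :: 'f mat))"
  unfolding linear_code_dist_def
proof (intro conjI ballI impI code)
  let ?x = "\<lambda>w :: 'a set \<Rightarrow> 'f. vec (length es) (\<lambda>j. w (es ! j))"
  have zero: "?x w = 0\<^sub>v (length es) \<longleftrightarrow> (\<forall>e\<in>E. w e = 0)" for w
    by (simp add: vec_eq_iff all_set_conv_all_nth flip: es(2))
  note weight = hamming_weight_vec_edge_function[OF es(1), unfolded es(2)]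
  note mem = mem_mat_kernel_incidence_list[OF es(1), where vs = vs, unfolded es(2) vs]
  obtain w :: "'a set \<Rightarrow> 'f" where w: "\<forall>v\<in>V. vertex_sum E w v = 0" "card {e \<in> E. w e \<noteq> 0} = d"
    using attained by auto
  show "\<exists>x\<in>mat_kernel (incidence_list vs es :: 'f mat). x \<noteq> 0\<^sub>v (length es) \<and> hamming_weight x = d"
  proof (intro bexI conjI)
    show "?x w \<in> mat_kernel (incidence_list vs es)" using w(1) by (simp add: mem)
    show "hamming_weight (?x w) = d" using w(2) by (simp add: weight)
    show "?x w \<noteq> 0\<^sub>v (length es)"
    proof
      assume "?x w = 0\<^sub>v (length es)"
      hence "{e \<in> E. w e \<noteq> 0} = {}" using zero by blast
      with w(2) \<open>d \<noteq> 0\<close> show False by simp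
    qed
  qed
  fix x :: "'f vec" assume x: "x \<in> mat_kernel (incidence_list vs es)" "x \<noteq> 0\<^sub>v (length es)"
  hence "x \<in> carrier_vec (length es)"
    using mat_kernel_carrier[OF incidence_list_carrier] by blast
  then obtain w' where w': "x = ?x w'"
    using vec_edge_function[OF es(1)] by blast
  with x have "\<forall>v\<in>V. vertex_sum E w' v = 0" "\<exists>e\<in>E. w' e \<noteq> 0"
    using mem zero by blast+
  thus "d \<le> hamming_weight x"
    using bound unfolding w' weight by blast
qed

end

section \<open>The unit graph of a prime power modulus\<close>

text \<open>The prime \<open>2\<close> is included, so that both families share the edge count and
  the connectivity.\<close>

locale prime_power_unit_graph =
  fixes p n :: nat
  assumes prime_p: "prime p" and n_pos: "1 \<le> n"
begin

definition N :: nat where "N = p ^ n"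
definition V :: "int set" where "V = carrier (residue_ring (int N))"
definition E :: "int set set" where "E = unit_graph_edges (residue_ring (int N))"

lemma p_le_N: "p \<le> N"
  using self_le_power[of p n] prime_gt_0_nat[OF prime_p] n_pos by (simp add: N_def)

lemma p_dvd_N: "p dvd N"
  using n_pos by (simp add: N_def dvd_power)

lemma N_gt_1: "1 < N"
  using p_le_N prime_gt_1_nat[OF prime_p] by simp

lemma V_eq: "V = {0..<int N}"
  by (auto simp: V_def residue_ring_def)

lemma card_V: "card V = N"
  by (simp add: V_eq)

text \<open>A residue is a unit modulo \<open>p ^ n\<close> iff it is coprime to \<open>p\<close>.
  Hence adjacency of distinct vertices depends only on their classes modulo
  \<open>p\<close>.\<close>

lemma add_mem_Units_iff:
  "x \<oplus>\<^bsub>residue_ring (int N)\<^esub> y \<in> Units (residue_ring (int N)) \<longleftrightarrow> \<not> int p dvd x + y"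
proof -
  interpret residues "int N" "residue_ring (int N)"
    using N_gt_1 by unfold_locales auto
  have "x \<oplus>\<^bsub>residue_ring (int N)\<^esub> y \<in> Units (residue_ring (int N))
      \<longleftrightarrow> coprime ((x + y) mod int N) (int N)"
    using N_gt_1 pos_mod_bound[of "int N" "x + y"] pos_mod_sign[of "int N" "x + y"]
    by (auto simp: res_units_eq res_add_eq le_less)
  also have "\<dots> \<longleftrightarrow> coprime (x + y) (int N)"
    using N_gt_1 by (simp add: coprime_mod_left_iff)
  also have "\<dots> \<longleftrightarrow> coprime (x + y) (int p ^ n)"
    by (simp add: N_def)
  also have "\<dots> \<longleftrightarrow> \<not> int p dvd x + y"
    using n_pos prime_p
    by (metis coprime_absorb_left coprime_commute coprime_power_right_iff not_one_le_zero
        not_prime_unit prime_imp_coprime prime_nat_int_transfer)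
  finally show ?thesis .
qed

lemma E_eq: "E = {{x, y} | x y. x \<in> V \<and> y \<in> V \<and> x \<noteq> y \<and> \<not> int p dvd x + y}"
  by (simp add: E_def V_def unit_graph_edges_def add_mem_Units_iff)

lemma edge_iff: "{x, y} \<in> E \<longleftrightarrow> x \<in> V \<and> y \<in> V \<and> x \<noteq> y \<and> \<not> int p dvd x + y"
  unfolding E_eq by (auto simp: doubleton_eq_iff add.commute)

sublocale finite_simple_graph V E
  by unfold_locales (auto simp: V_eq E_eq)

text \<open>Translation by \<open>x\<close> permutes the ring, so the count is the number of units.
  It includes \<open>y = x\<close> whenever \<open>2 * x\<close> is a unit.\<close>

lemma card_unit_sums:
  assumes "x \<in> V"
  shows "card {y \<in> V. \<not> int p dvd x + y} = totient N"
proof -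
  let ?R = "residue_ring (int N)"
  interpret residues "int N" ?R
    using N_gt_1 by unfold_locales auto
  have x: "x \<in> carrier ?R" using assms by (simp add: V_def)
  have "bij_betw (\<lambda>y. x \<oplus>\<^bsub>?R\<^esub> y) {y \<in> carrier ?R. x \<oplus>\<^bsub>?R\<^esub> y \<in> Units ?R} (Units ?R)"
    by (rule bij_betw_byWitness[where f' = "\<lambda>u. \<ominus>\<^bsub>?R\<^esub> x \<oplus>\<^bsub>?R\<^esub> u"])
      (use x Units_closed in \<open>auto simp: r_neg1 r_neg2\<close>)
  hence "card {y \<in> carrier ?R. x \<oplus>\<^bsub>?R\<^esub> y \<in> Units ?R} = card (Units ?R)"
    by (rule bij_betw_same_card)
  thus ?thesis
    using totient_eq by (simp add: V_def add_mem_Units_iff)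
qed

text \<open>Count the ordered pairs with unit sum: each edge arises twice, and each diagonal pair
  once.\<close>

lemma twice_card_E: "2 * card E + card {x \<in> V. \<not> int p dvd 2 * x} = N * totient N"
proof -
  \<comment> \<open>\<open>P\<close> holds all these pairs, \<open>L\<close> one pair for each edge,
    and \<open>D\<close> the diagonal.\<close>
  define P where "P = {(x, y). x \<in> V \<and> y \<in> V \<and> \<not> int p dvd x + y}"
  define L where "L = {(x, y) \<in> P. x < y}"
  define D where "D = {x \<in> V. \<not> int p dvd 2 * x}"
  have "P \<subseteq> V \<times> V" by (auto simp: P_def)
  hence finP: "finite P" using finite_V finite_subset by blast
  have "L \<subseteq> P" "D \<subseteq> V" by (auto simp: L_def D_def)
  hence fin: "finite L" "finite D"
    using finP finite_V finite_subset by blast+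
  have "P = (SIGMA x:V. {y \<in> V. \<not> int p dvd x + y})" by (auto simp: P_def)
  hence "card P = (\<Sum>x\<in>V. card {y \<in> V. \<not> int p dvd x + y})"
    using finite_V by simp
  hence card_P: "card P = N * totient N"
    using card_V by (simp add: card_unit_sums)
  have "inj_on (\<lambda>(x, y). {x, y}) L"
    by (auto simp: inj_on_def L_def doubleton_eq_iff)
  moreover have "E = (\<lambda>(x, y). {x, y}) ` L"
  proof (intro equalityI subsetI)
    fix e assume "e \<in> E"
    then obtain x y where "e = {x, y}" "x \<in> V" "y \<in> V" "x \<noteq> y" "\<not> int p dvd x + y"
      by (auto simp: E_eq)
    hence "e = {min x y, max x y}" "(min x y, max x y) \<in> L"
      by (auto simp: L_def P_def min_def max_def add.commute)
    thus "e \<in> (\<lambda>(x, y). {x, y}) ` L" by force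
  qed (auto simp: L_def P_def edge_iff)
  ultimately have card_L: "card L = card E"
    by (simp add: card_image)
  have P_split: "P = (L \<union> prod.swap ` L) \<union> (\<lambda>x. (x, x)) ` D"
  proof -
    have "(x, y) \<in> P \<longleftrightarrow> (y, x) \<in> P" for x y
      by (auto simp: P_def add.commute)
    moreover have "(x, x) \<in> P \<longleftrightarrow> x \<in> D" for x
      by (simp add: P_def D_def flip: mult_2)
    ultimately have "z \<in> P \<longleftrightarrow> z \<in> (L \<union> prod.swap ` L) \<union> (\<lambda>x. (x, x)) ` D" for z
      by (cases z, cases "fst z" "snd z" rule: linorder_cases) (auto simp: L_def image_iff)
    thus ?thesis by blast
  qed
  have "card ((L \<union> prod.swap ` L) \<union> (\<lambda>x. (x, x)) ` D)
      = card (L \<union> prod.swap ` L) + card ((\<lambda>x. (x, x)) ` D)"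
    by (rule card_Un_disjoint) (use fin in \<open>auto simp: L_def\<close>)
  also have "card (L \<union> prod.swap ` L) = card L + card (prod.swap ` L)"
    by (rule card_Un_disjoint) (use fin in \<open>auto simp: L_def\<close>)
  also have "card (prod.swap ` L) = card L"
    by (rule card_image) (auto simp: inj_on_def)
  also have "card ((\<lambda>x. (x, x)) ` D) = card D"
    by (rule card_image) (auto simp: inj_on_def)
  finally show ?thesis
    using card_P card_L P_split by (simp add: D_def)
qed

text \<open>The ring is local: \<open>0\<close> is adjacent to every unit, and \<open>1\<close> to every nonunit.\<close>

lemma connected:
  assumes v: "v \<in> V"
  shows "(0, v) \<in> {(x, y). {x, y} \<in> E}\<^sup>*"
proof -
  have zero: "0 \<in> V" and one: "1 \<in> V" using N_gt_1 by (auto simp: V_eq)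
  have not_unit: "\<not> int p dvd 1" using prime_p prime_gt_1_nat[OF prime_p] by simp
  show ?thesis
  proof (cases "int p dvd v")
    case False
    hence "{0, v} \<in> E" using v zero by (auto simp: edge_iff)
    thus ?thesis by auto
  next
    case True
    hence "\<not> int p dvd 1 + v" "v \<noteq> 1"
      using not_unit by (auto simp: dvd_add_left_iff)
    hence "{1, v} \<in> E" using v one by (auto simp: edge_iff)
    moreover have "{0, 1} \<in> E" using zero one not_unit by (auto simp: edge_iff)
    ultimately have "(0, 1) \<in> {(x, y). {x, y} \<in> E}" "(1, v) \<in> {(x, y). {x, y} \<in> E}"
      by simp_all
    thus ?thesis by (rule rtrancl.rtrancl_into_rtrancl[OF r_into_rtrancl])
  qed
qed

lemma dual_code_obtain:
  assumes "unit_graph_incidence N H"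
  obtains vs es where "distinct vs" "set vs = V" "distinct es" "set es = E"
    "vec_module.orthogonal_complement (dim_col H) (row_code H :: 'f::field vec set)
      = mat_kernel (incidence_list vs es)"
  using assms dual_row_code
  unfolding unit_graph_incidence_def is_incidence_matrix_def V_def[symmetric] E_def[symmetric]
  by metis

end

section \<open>Parameters of the two families of dual codes\<close>

lemma odd_prime_power_dual_code:
  assumes p: "prime p" "odd p" and n: "1 \<le> n" and not_3: "p ^ n \<noteq> 3"
    and card: "CARD('f::field) = 2" and H: "unit_graph_incidence (p ^ n) H"
  shows "linear_code_dist ((p ^ n - 1) * totient (p ^ n) div 2)
    ((p ^ n - 1) * (totient (p ^ n) - 2) div 2) 3
    (vec_module.orthogonal_complement (dim_col H) (row_code H :: 'f vec set))"
proof -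
  interpret prime_power_unit_graph p n using p n by unfold_locales
  obtain vs es where vs: "distinct vs" "set vs = V" and es: "distinct es" "set es = E"
    and dual: "vec_module.orthogonal_complement (dim_col H) (row_code H :: 'f vec set)
      = mat_kernel (incidence_list vs es)"
    using dual_code_obtain H[folded N_def] by metis
  have "p > 2" using p prime_ge_2_nat[OF p(1)] by (cases "p = 2") auto
  have "N > 3"
    using p_le_N \<open>p > 2\<close> not_3 by (simp add: N_def)
  have char_2: "(1 :: 'f) + 1 = 0"
  proof -
    have "card {0, 1 :: 'f} = CARD('f)" using card by simp
    hence "{0, 1} = (UNIV :: 'f set)"
      using card by (intro card_subset_eq) (auto intro: card_ge_0_finite)
    hence "1 + 1 = (0 :: 'f) \<or> 1 + 1 = (1 :: 'f)" by blast
    moreover have "1 + 1 \<noteq> (1 :: 'f)"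
      by (metis add_cancel_right_right one_neq_zero)
    ultimately show ?thesis by blast
  qed
  have dvd_double: "int p dvd 2 * x \<longleftrightarrow> int p dvd x" for x :: int
    using p \<open>p > 2\<close> by (auto simp: prime_dvd_mult_iff dest: zdvd_imp_le)
  \<comment> \<open>Doubling preserves divisibility by an odd \<open>p\<close>, so the diagonal
    accounts for \<open>totient N\<close> pairs.\<close>
  have "card {x \<in> V. \<not> int p dvd 2 * x} = totient N"
    unfolding dvd_double using card_unit_sums[of 0] N_gt_1 by (simp add: V_eq)
  hence "2 * card E = N * totient N - totient N" using twice_card_E by linarith
  hence card_E: "2 * card E = (N - 1) * totient N" by (simp add: diff_mult_distrib)
  \<comment> \<open>Evenness makes both halvings in the parameters exact.\<close>
  have "even (totient N)" using totient_even \<open>N > 3\<close> by simp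
  then obtain m where m: "totient N = 2 * m" by blast
  have "(N - 1) * (2 * m - 2) = 2 * ((N - 1) * m - (N - 1))"
    by (simp add: algebra_simps)
  hence dim: "(N - 1) * (totient N - 2) div 2 = card E - (card V - 1)"
    using card_E card_V unfolding m by simp
  have len: "(N - 1) * totient N div 2 = length es"
    using card_E es distinct_card[of es] by simp
  have "linear_code (length es) (card E - (card V - 1)) (mat_kernel (incidence_list vs es :: 'f mat))"
  proof (rule linear_code_dual_incidence[where c = "\<lambda>_. 1", OF vs es connected])
    show "(0::int) \<in> V" using N_gt_1 by (simp add: V_eq)
  qed (use char_2 in auto)
  hence "linear_code_dist (length es) (card E - (card V - 1)) 3
    (mat_kernel (incidence_list vs es :: 'f mat))"
  proof (rule minimum_distance_dual_incidence[OF es _ vs(2)])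
    \<comment> \<open>For \<open>p > 3\<close> the vertices \<open>0, 1, 2\<close> have pairwise
      sums \<open>1, 2, 3\<close>. For \<open>p = 3\<close> the sum \<open>1 + 2\<close> fails;
      \<open>0, 1, 4\<close> with sums \<open>1, 4, 5\<close> serve instead, and \<open>4\<close> is
      a vertex because \<open>N > 3\<close> is a multiple of \<open>3\<close>.\<close>
    have "\<exists>a b c. {a, b} \<in> E \<and> {b, c} \<in> E \<and> {a, c} \<in> E"
    proof (cases "p = 3")
      case True
      hence "3 dvd N" using p_dvd_N by metis
      with \<open>N > 3\<close> have "N > 4" by presburger
      have "{0, 1} \<in> E" "{1, 4} \<in> E" "{0, 4} \<in> E"
        unfolding edge_iff V_eq using \<open>N > 4\<close> True by auto
      thus ?thesis by blast
    next
      case False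
      hence "p > 3" using \<open>p > 2\<close> by simp
      have "{0, 1} \<in> E" "{1, 2} \<in> E" "{0, 2} \<in> E"
        using \<open>N > 3\<close> \<open>p > 3\<close> by (auto simp: edge_iff V_eq dest: zdvd_imp_le)
      thus ?thesis by blast
    qed
    then obtain a b c where "{a, b} \<in> E" "{b, c} \<in> E" "{a, c} \<in> E" by blast
    from triangle_cycle_space[OF this char_2]
    show "\<exists>w :: int set \<Rightarrow> 'f. (\<forall>v\<in>V. vertex_sum E w v = 0) \<and> card {e \<in> E. w e \<noteq> 0} = 3"
      by (rule ex_forward) simp
    show "3 \<le> card {e \<in> E. w e \<noteq> 0}"
      if "\<forall>v\<in>V. vertex_sum E w v = 0" "e \<in> E" "w e \<noteq> 0" for w :: "int set \<Rightarrow> 'f" and e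
      using cycle_space_support(1)[OF that] .
  qed simp
  thus ?thesis
    unfolding dual len[unfolded N_def] dim[unfolded N_def] .
qed

text \<open>The graph is complete bipartite between even and odd residues, with
  \<open>2 ^ (n - 1)\<close> vertices on each side. The dimension has the form
  \<open>card E - (card V - 1)\<close>, which is correct also for \<open>n = 1\<close>; the 4-cycle
  needs four vertices, hence \<open>n \<ge> 2\<close> for the distance.\<close>

lemma two_power_dual_code:
  assumes n: "1 \<le> n" and H: "unit_graph_incidence (2 ^ n) H"
  shows "linear_code (2 ^ (2 * (n - 1))) (2 ^ (2 * (n - 1)) - (2 ^ n - 1))
      (vec_module.orthogonal_complement (dim_col H) (row_code H :: 'f::field vec set))"
    and "2 \<le> n \<Longrightarrow> linear_code_dist (2 ^ (2 * (n - 1))) (2 ^ (2 * (n - 1)) - (2 ^ n - 1)) 4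
      (vec_module.orthogonal_complement (dim_col H) (row_code H :: 'f::field vec set))"
proof -
  interpret prime_power_unit_graph 2 n using n by unfold_locales auto
  obtain vs es where vs: "distinct vs" "set vs = V" and es: "distinct es" "set es = E"
    and dual: "vec_module.orthogonal_complement (dim_col H) (row_code H :: 'f vec set)
      = mat_kernel (incidence_list vs es)"
    using dual_code_obtain H[folded N_def] by metis
  \<comment> \<open>An odd sum already implies that the endpoints differ.\<close>
  have edge_parity: "{x, y} \<in> E \<longleftrightarrow> x \<in> V \<and> y \<in> V \<and> odd (x + y)" for x y
    by (auto simp: edge_iff)
  obtain m where m: "n = Suc m" using n by (cases n) auto
  have N: "N = 2 * 2 ^ m" unfolding N_def by (simp add: m)
  have "totient N = 2 ^ m"
    unfolding N_def using totient_prime_power_Suc[of 2 m] by (simp add: m)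
  hence "card E = 2 ^ m * 2 ^ m"
    using twice_card_E N by simp
  also have "\<dots> = 2 ^ (2 * (n - 1))"
    unfolding power_add[symmetric] by (simp add: m)
  finally have card_E: "card E = 2 ^ (2 * (n - 1))" .
  hence len: "length es = 2 ^ (2 * (n - 1))"
    using es distinct_card[of es] by simp
  have "linear_code (length es) (card E - (card V - 1)) (mat_kernel (incidence_list vs es :: 'f mat))"
  proof (rule linear_code_dual_incidence[OF vs es connected])
    show "(0::int) \<in> V" using N_gt_1 by (simp add: V_eq)
    show "(if even u then 1 else - 1) + (if even v then 1 else - 1) = (0 :: 'f)"
      if "{u, v} \<in> E" for u v :: int
      using that by (auto simp: edge_parity)
  qed auto
  hence code: "linear_code (length es) (2 ^ (2 * (n - 1)) - (2 ^ n - 1))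
      (mat_kernel (incidence_list vs es :: 'f mat))"
    by (simp add: card_E card_V N_def)
  thus "linear_code (2 ^ (2 * (n - 1))) (2 ^ (2 * (n - 1)) - (2 ^ n - 1))
      (vec_module.orthogonal_complement (dim_col H) (row_code H :: 'f vec set))"
    by (simp add: dual len)
  assume "2 \<le> n"
  hence "N \<ge> 4" using power_increasing[of 2 n "2::nat"] by (simp add: N_def)
  have "linear_code_dist (length es) (2 ^ (2 * (n - 1)) - (2 ^ n - 1)) 4
    (mat_kernel (incidence_list vs es :: 'f mat))"
  proof (rule minimum_distance_dual_incidence[OF es code vs(2)])
    have square: "{0, 1} \<in> E" "{1, 2} \<in> E" "{2, 3} \<in> E" "{0, 3} \<in> E"
      using \<open>N \<ge> 4\<close> by (auto simp: edge_parity V_eq)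
    have "(0::int) \<noteq> 2" "(1::int) \<noteq> 3" by simp_all
    from square_cycle_space[OF square this]
    show "\<exists>w :: int set \<Rightarrow> 'f. (\<forall>v\<in>V. vertex_sum E w v = 0) \<and> card {e \<in> E. w e \<noteq> 0} = 4"
      by (rule ex_forward) simp
    show "4 \<le> card {e \<in> E. w e \<noteq> 0}"
      if "\<forall>v\<in>V. vertex_sum E w v = 0" "e \<in> E" "w e \<noteq> 0" for w :: "int set \<Rightarrow> 'f" and e
    proof (rule cycle_space_support(2)[OF that])
      \<comment> \<open>Two steps along edges preserve parity, so \<open>a + c\<close> is
        even.\<close>
      show "{a, c} \<notin> E" if "{a, b} \<in> E" "{b, c} \<in> E" for a b c
        using that by (auto simp: edge_parity)
    qed
  qed simp
  thus "linear_code_dist (2 ^ (2 * (n - 1))) (2 ^ (2 * (n - 1)) - (2 ^ n - 1)) 4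
      (vec_module.orthogonal_complement (dim_col H) (row_code H :: 'f vec set))"
    by (simp add: dual len)
qed

theorem corollary3p8:
  shows
    "(\<forall>(p::nat) (n::nat) (H::int mat).
        prime p \<and> odd p \<and> 1 \<le> n \<and> p ^ n \<noteq> 3 \<and> CARD('a) = 2 \<and>
        unit_graph_incidence (p ^ n) H
        \<longrightarrow> linear_code_dist
              ((p ^ n - 1) * totient (p ^ n) div 2)
              ((p ^ n - 1) * (totient (p ^ n) - 2) div 2)
              3
              (vec_module.orthogonal_complement (dim_col H) (row_code H :: 'a::field vec set)))
     \<and>
     (\<forall>(n::nat) (q::nat) (H::int mat).
        1 \<le> n \<and> prime q \<and> odd q \<and> CARD('b) = q \<and>
        unit_graph_incidence (2 ^ n) H
        \<longrightarrow> (2 \<le> n \<longrightarrow>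
               linear_code_dist
                 (2 ^ (2 * (n - 1)))
                 (2 ^ n * (2 ^ (n - 2) - 1) + 1)
                 4
                 (vec_module.orthogonal_complement (dim_col H) (row_code H :: 'b::field vec set)))
           \<and> (n = 1 \<longrightarrow>
               linear_code 1 0 (vec_module.orthogonal_complement (dim_col H) (row_code H :: 'b::field vec set))))"
proof (intro conjI allI impI)
  fix p n :: nat and H :: "int mat"
  assume "prime p \<and> odd p \<and> 1 \<le> n \<and> p ^ n \<noteq> 3 \<and> CARD('a) = 2 \<and> unit_graph_incidence (p ^ n) H"
  thus "linear_code_dist ((p ^ n - 1) * totient (p ^ n) div 2)
      ((p ^ n - 1) * (totient (p ^ n) - 2) div 2) 3
      (vec_module.orthogonal_complement (dim_col H) (row_code H :: 'a vec set))"
    by (elim conjE) (rule odd_prime_power_dual_code)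
next
  fix n q :: nat and H :: "int mat"
  assume asm: "1 \<le> n \<and> prime q \<and> odd q \<and> CARD('b) = q \<and> unit_graph_incidence (2 ^ n) H"
  show "linear_code_dist (2 ^ (2 * (n - 1))) (2 ^ n * (2 ^ (n - 2) - 1) + 1) 4
      (vec_module.orthogonal_complement (dim_col H) (row_code H :: 'b vec set))" if n: "2 \<le> n"
  proof -
    have "2 * (n - 1) = n + (n - 2)" using n by simp
    hence "2 ^ (2 * (n - 1)) = (2 ^ n * 2 ^ (n - 2) :: nat)"
      by (simp only: power_add)
    \<comment> \<open>This bound allows the natural-number subtraction to be rearranged without
      truncation.\<close>
    moreover have "(2 ^ n :: nat) \<le> 2 ^ n * 2 ^ (n - 2)" by simp
    ultimately have "2 ^ (2 * (n - 1)) - (2 ^ n - 1) = (2 ^ n * (2 ^ (n - 2) - 1) + 1 :: nat)"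
      by (simp add: diff_mult_distrib2 Suc_diff_le)
    thus ?thesis using two_power_dual_code(2)[of n H] asm n by simp
  qed
  \<comment> \<open>At \<open>n = 1\<close> there is one edge and the dimension is
    \<open>1 - (2 - 1) = 0\<close>.\<close>
  show "linear_code 1 0 (vec_module.orthogonal_complement (dim_col H) (row_code H :: 'b vec set))"
    if "n = 1"
    using two_power_dual_code(1)[of n H] asm that by simp
qed

end
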